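(* Consider the Gaussian sequence model with parameter space $\Theta(k_n,\tau_n)$, and let $\epsilon_n=k_n/n$, $\mu_n=\tau_n/\sigma_n$. Suppose $\epsilon_n\to0$ and $\mu_n\to0$ as $n\to\infty$. Then $$R(\Theta(k_n,\tau_n),\sigma_n)=n\sigma_n^2\left(\epsilon_n\mu_n^2-\epsilon_n^2\mu_n^4(1+o(1))\right).$$ In addition, the linear estimator $\hat\eta_L(y,\lambda_n)$ with $\lambda_n=(\epsilon_n\mu_n^2)^{-1}$ is asymptotically minimax up to the second order term, i.e. $$\sup_{\theta\in\Theta(k_n,\tau_n)}\mathbb E_\theta\|\hat\eta_L(y,\lambda_n)-\theta\|_2^2=n\sigma_n^2\left(\epsilon_n\mu_n^2-\epsilon_n^2\mu_n^4(1+o(1))\right).$$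
   Context: Model: for each $n$, one observes $y=(y_1,\dots,y_n)$ with $y_i=\theta_i+\sigma_n z_i$, where $z_i$ are i.i.d. $\mathcal N(0,1)$, $\sigma_n>0$ is known and $\theta\in\mathbb R^n$ is unknown. For integers $1\le k_n\le n$ and $\tau_n>0$, $$\Theta(k_n,\tau_n)=\{\theta\in\mathbb R^n:\ \|\theta\|_0\le k_n,\ \|\theta\|_2^2\le k_n\tau_n^2\},$$ where $\|\theta\|_0$ is the number of nonzero coordinates. The minimax risk is $R(\Theta(k_n,\tau_n),\sigma_n)=\inf_{\hat\theta}\sup_{\theta\in\Theta(k_n,\tau_n)}\mathbb E_\theta\|\hat\theta-\theta\|_2^2$, the infimum being over all estimators (measurable functions of $y$). The linear estimator has coordinates $[\hat\eta_L(y,\lambda)]_i=\frac{y_i}{1+\lambda}$. Here $o(1)$ denotes a sequence tending to $0$ as $n\to\infty$. *)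

theory Defs
  imports "HOL-Probability.Probability"
begin

text \<open>
  Vectors in \<open>\<real>\<^sup>n\<close> are the extensional functions on \<open>{..<n}\<close>, since the dimension varies
  along the sequence.
\<close>

abbreviation vec_space :: "nat \<Rightarrow> (nat \<Rightarrow> real) measure" where
  "vec_space n \<equiv> PiM {..<n} (\<lambda>_. borel)"

definition l0_norm :: "nat \<Rightarrow> (nat \<Rightarrow> real) \<Rightarrow> nat" where
  "l0_norm n \<theta> = card {i \<in> {..<n}. \<theta> i \<noteq> 0}"

definition sq_norm :: "nat \<Rightarrow> (nat \<Rightarrow> real) \<Rightarrow> real" where
  "sq_norm n \<theta> = (\<Sum>i<n. (\<theta> i)\<^sup>2)"

definition param_space :: "nat \<Rightarrow> nat \<Rightarrow> real \<Rightarrow> (nat \<Rightarrow> real) set" where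
  "param_space n k \<tau> =
     {\<theta> \<in> {..<n} \<rightarrow>\<^sub>E UNIV. l0_norm n \<theta> \<le> k \<and> sq_norm n \<theta> \<le> real k * \<tau>\<^sup>2}"

definition gaussian_noise :: "nat \<Rightarrow> (nat \<Rightarrow> real) measure" where
  "gaussian_noise n =
     PiM {..<n} (\<lambda>_. density lborel (\<lambda>x. ennreal (std_normal_density x)))"

definition observation :: "nat \<Rightarrow> real \<Rightarrow> (nat \<Rightarrow> real) \<Rightarrow> (nat \<Rightarrow> real) \<Rightarrow> (nat \<Rightarrow> real)" where
  "observation n \<sigma> \<theta> z = (\<lambda>i\<in>{..<n}. \<theta> i + \<sigma> * z i)"

text \<open>
  The risk is a nonnegative extended real: it may be infinite for some estimators, and those
  must not be assigned the default value 0 of a non-convergent Bochner integral.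
\<close>

definition mse ::
  "nat \<Rightarrow> real \<Rightarrow> ((nat \<Rightarrow> real) \<Rightarrow> (nat \<Rightarrow> real)) \<Rightarrow> (nat \<Rightarrow> real) \<Rightarrow> ennreal" where
  "mse n \<sigma> est \<theta> =
     (\<integral>\<^sup>+ z. ennreal (sq_norm n (\<lambda>i. est (observation n \<sigma> \<theta> z) i - \<theta> i)) \<partial>gaussian_noise n)"

definition worst_case_risk ::
  "nat \<Rightarrow> (nat \<Rightarrow> real) set \<Rightarrow> real \<Rightarrow> ((nat \<Rightarrow> real) \<Rightarrow> (nat \<Rightarrow> real)) \<Rightarrow> ennreal" where
  "worst_case_risk n \<Theta> \<sigma> est = (SUP \<theta>\<in>\<Theta>. mse n \<sigma> est \<theta>)"

definition minimax_risk :: "nat \<Rightarrow> (nat \<Rightarrow> real) set \<Rightarrow> real \<Rightarrow> ennreal" where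
  "minimax_risk n \<Theta> \<sigma> =
     (INF est \<in> vec_space n \<rightarrow>\<^sub>M vec_space n. worst_case_risk n \<Theta> \<sigma> est)"

definition linear_estimator :: "nat \<Rightarrow> real \<Rightarrow> (nat \<Rightarrow> real) \<Rightarrow> (nat \<Rightarrow> real)" where
  "linear_estimator n lam y = (\<lambda>i\<in>{..<n}. y i / (1 + lam))"

end

theory Submission
  imports Defs "HOL-Real_Asymp.Real_Asymp"
begin

text \<open>
  The risk of the linear estimator is a function of \<open>sq_norm n \<theta>\<close> alone, so its supremum is exactly
  \<open>n \<sigma>\<^sup>2 a / (1 + a)\<close> with \<open>a = \<epsilon> \<mu>\<^sup>2\<close>; this also bounds the minimax risk from above.

  For the lower bound, cut the coordinates into \<open>k\<close> blocks of length \<open>m = n div k\<close> and put in each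
  block one spike \<open>\<plusminus>\<tau>\<close> at a uniformly random position, independently. Even when the spikes of the
  other blocks are known, the Bayes risk in one block is \<open>\<tau>\<^sup>2\<close> minus the second moment of the posterior
  mean, whose \<open>i\<close>-th coordinate is \<open>\<tau> sinh (\<mu> y\<^sub>i / \<sigma>) / \<Sum>\<^sub>j cosh (\<mu> y\<^sub>j / \<sigma>)\<close>. Since \<open>cosh \<ge> 1\<close>, the
  denominator is at least \<open>m\<close>, and integrating against the spike-free noise gives
  \<open>\<tau>\<^sup>2 - \<tau>\<^sup>2 exp (-\<mu>\<^sup>2/2) (exp (2\<mu>\<^sup>2) - 1) / (2m)\<close>, in which the subtracted term is
  \<open>\<tau>\<^sup>2 \<mu>\<^sup>2 / m\<close> up to a factor tending to 1.
\<close>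

section \<open>Gaussian noise: change of measure under a shift, exponential and first two
  moments\<close>

abbreviation std_gauss :: "real measure" where
  "std_gauss \<equiv> density lborel (\<lambda>x. ennreal (std_normal_density x))"

lemma prob_space_std_gauss: "prob_space std_gauss"
  by (rule prob_space_normal_density) simp

lemma product_sigma_finite_std_gauss: "product_sigma_finite (\<lambda>_ :: nat. std_gauss)"
  using prob_space_std_gauss
  by (simp add: product_sigma_finite_def prob_space_imp_sigma_finite)

lemma prob_space_gaussian_noise: "prob_space (gaussian_noise n)"
  unfolding gaussian_noise_def using prob_space_std_gauss by (intro prob_space_PiM)

lemma sets_gaussian_noise [measurable_cong]: "sets (gaussian_noise n) = sets (vec_space n)"
  unfolding gaussian_noise_def by (intro sets_PiM_cong) simp_all

lemma distr_gaussian_noise: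
  assumes "i < n"
  shows "distr (gaussian_noise n) std_gauss (\<lambda>z. z i) = std_gauss"
  unfolding gaussian_noise_def
  using assms prob_space_std_gauss by (intro distr_PiM_component) auto

text \<open>Translate the integration variable by \<open>-a\<close>: the factor
  \<open>exp (a * x - a\<^sup>2 / 2)\<close> is the density ratio of the normal law with mean
  \<open>a\<close> to the centred one.\<close>

lemma nn_integral_std_gauss_shift:
  fixes a :: real
  assumes [measurable]: "g \<in> borel_measurable borel"
  shows "(\<integral>\<^sup>+ x. g (x + a) \<partial>std_gauss) = (\<integral>\<^sup>+ x. g x * ennreal (exp (a * x - a\<^sup>2 / 2)) \<partial>std_gauss)"
proof -
  have "(\<integral>\<^sup>+ x. g (x + a) \<partial>std_gauss) = (\<integral>\<^sup>+ x. ennreal (std_normal_density x) * g (x + a) \<partial>lborel)"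
    by (subst nn_integral_density) auto
  also have "\<dots> = (\<integral>\<^sup>+ x. ennreal (std_normal_density (-a + 1 * x)) * g ((-a + 1 * x) + a) \<partial>lborel)"
    using nn_integral_real_affine[of "\<lambda>x. ennreal (std_normal_density x) * g (x + a)" 1 "-a"]
    by simp
  also have "\<dots> = (\<integral>\<^sup>+ x. ennreal (std_normal_density x) * (g x * ennreal (exp (a * x - a\<^sup>2 / 2))) \<partial>lborel)"
  proof (intro nn_integral_cong)
    fix x :: real
    have "std_normal_density (-a + 1 * x) = std_normal_density x * exp (a * x - a\<^sup>2 / 2)"
      by (simp add: std_normal_density_def power2_eq_square field_simps flip: exp_add)
    thus "ennreal (std_normal_density (-a + 1 * x)) * g ((-a + 1 * x) + a) =
        ennreal (std_normal_density x) * (g x * ennreal (exp (a * x - a\<^sup>2 / 2)))"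
      by (simp add: ennreal_mult mult_ac)
  qed
  also have "\<dots> = (\<integral>\<^sup>+ x. g x * ennreal (exp (a * x - a\<^sup>2 / 2)) \<partial>std_gauss)"
    by (subst nn_integral_density) auto
  finally show ?thesis .
qed

text \<open>Only coordinate \<open>j\<close> moves, so Fubini isolates it and the one-dimensional
  formula applies. This refers all positions of a spike to one spike-free noise law, under which
  integrands can be compared pointwise.\<close>

lemma nn_integral_gaussian_noise_shift:
  fixes a :: real
  assumes f: "f \<in> borel_measurable (vec_space n)" and j: "j < n"
  shows "(\<integral>\<^sup>+ z. f (z(j := z j + a)) \<partial>gaussian_noise n) =
         (\<integral>\<^sup>+ z. f z * ennreal (exp (a * z j - a\<^sup>2 / 2)) \<partial>gaussian_noise n)"
proof -
  interpret product_sigma_finite "\<lambda>_ :: nat. std_gauss" by (rule product_sigma_finite_std_gauss)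
  define I where "I = {..<n} - {j}"
  have I: "finite I" "j \<notin> I" and ins: "insert j I = {..<n}" using j by (auto simp: I_def)
  have jj: "j \<in> {..<n}" using j by simp
  let ?M = "PiM {..<n} (\<lambda>_. std_gauss)"
  have f' [measurable]: "f \<in> borel_measurable ?M"
    using f by (simp cong: measurable_cong_sets sets_PiM_cong)
  have [measurable]: "(\<lambda>z. z j) \<in> borel_measurable ?M"
    using measurable_component_singleton[OF jj, of "\<lambda>_. std_gauss"] by simp
  have upd: "(\<lambda>z. z(j := z j + a)) \<in> measurable ?M ?M"
    by (rule measurable_fun_upd[where J = "{..<n}"]) (use jj in auto)
  have m1: "(\<lambda>z. f (z(j := z j + a))) \<in> borel_measurable (PiM (insert j I) (\<lambda>_. std_gauss))"
    unfolding ins using measurable_compose[OF upd f'] .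
  have m2: "(\<lambda>z. f z * ennreal (exp (a * z j - a\<^sup>2 / 2))) \<in> borel_measurable (PiM (insert j I) (\<lambda>_. std_gauss))"
    unfolding ins by measurable
  have "(\<integral>\<^sup>+ z. f (z(j := z j + a)) \<partial>?M) =
      (\<integral>\<^sup>+ x. (\<integral>\<^sup>+ y. f (x(j := y + a)) \<partial>std_gauss) \<partial>PiM I (\<lambda>_. std_gauss))"
    using product_nn_integral_insert[OF I m1] unfolding ins by simp
  also have "\<dots> = (\<integral>\<^sup>+ x. (\<integral>\<^sup>+ y. f (x(j := y)) * ennreal (exp (a * y - a\<^sup>2 / 2)) \<partial>std_gauss) \<partial>PiM I (\<lambda>_. std_gauss))"
  proof (rule nn_integral_cong)
    fix x assume x: "x \<in> space (PiM I (\<lambda>_. std_gauss))"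
    have "(\<lambda>y. x(j := y)) \<in> measurable std_gauss (PiM (insert j I) (\<lambda>_. std_gauss))"
      using x I by (intro measurable_fun_upd[where J = I]) auto
    hence "(\<lambda>y. f (x(j := y))) \<in> borel_measurable std_gauss"
      unfolding ins by (rule measurable_compose) (rule f')
    thus "(\<integral>\<^sup>+ y. f (x(j := y + a)) \<partial>std_gauss) =
        (\<integral>\<^sup>+ y. f (x(j := y)) * ennreal (exp (a * y - a\<^sup>2 / 2)) \<partial>std_gauss)"
      using nn_integral_std_gauss_shift[of "\<lambda>y. f (x(j := y))" a] by simp
  qed
  also have "\<dots> = (\<integral>\<^sup>+ z. f z * ennreal (exp (a * z j - a\<^sup>2 / 2)) \<partial>?M)"
    using product_nn_integral_insert[OF I m2] unfolding ins by simp
  finally show ?thesis unfolding gaussian_noise_def .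
qed

text \<open>Shifting the constant function 1 shows that the density ratio has total mass 1, which is
  the moment generating function up to the factor \<open>exp (a\<^sup>2 / 2)\<close>.\<close>

lemma has_bochner_integral_gaussian_noise_exp:
  assumes "i < n"
  shows "has_bochner_integral (gaussian_noise n) (\<lambda>z. exp (a * z i)) (exp (a\<^sup>2 / 2))"
proof (rule has_bochner_integral_nn_integral)
  interpret prob_space "gaussian_noise n" by (rule prob_space_gaussian_noise)
  have i: "i \<in> {..<n}" using assms by simp
  show meas [measurable]: "(\<lambda>z. exp (a * z i)) \<in> borel_measurable (gaussian_noise n)"
    using i by measurable
  have "ennreal (exp (a\<^sup>2 / 2)) = (\<integral>\<^sup>+ z. 1 \<partial>gaussian_noise n) * ennreal (exp (a\<^sup>2 / 2))"
    by (simp add: emeasure_space_1)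
  also have "(\<integral>\<^sup>+ z. 1 \<partial>gaussian_noise n) = (\<integral>\<^sup>+ z. ennreal (exp (a * z i - a\<^sup>2 / 2)) \<partial>gaussian_noise n)"
    using nn_integral_gaussian_noise_shift[of "\<lambda>_. 1" n i a] assms by simp
  also have "\<dots> * ennreal (exp (a\<^sup>2 / 2)) =
      (\<integral>\<^sup>+ z. ennreal (exp (a * z i - a\<^sup>2 / 2)) * ennreal (exp (a\<^sup>2 / 2)) \<partial>gaussian_noise n)"
    using i by (subst nn_integral_multc) auto
  also have "\<dots> = (\<integral>\<^sup>+ z. ennreal (exp (a * z i)) \<partial>gaussian_noise n)"
    by (simp flip: ennreal_mult exp_add)
  finally show "(\<integral>\<^sup>+ z. ennreal (exp (a * z i)) \<partial>gaussian_noise n) = ennreal (exp (a\<^sup>2 / 2))" ..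
qed simp_all

lemma has_bochner_integral_gaussian_noise_linear:
  assumes "i < n"
  shows "has_bochner_integral (gaussian_noise n) (\<lambda>z. z i) 0"
    and "has_bochner_integral (gaussian_noise n) (\<lambda>z. (z i)\<^sup>2) 1"
proof -
  have c: "(\<lambda>z. z i) \<in> measurable (gaussian_noise n) std_gauss"
    using measurable_component_singleton[of i "{..<n}" "\<lambda>_. std_gauss"] assms
    by (simp add: gaussian_noise_def)
  have m1: "has_bochner_integral lborel (\<lambda>x. std_normal_density x * x ^ 1) 0"
    using std_normal_moment_odd[of 0] by simp
  have m2: "has_bochner_integral lborel (\<lambda>x. std_normal_density x * x\<^sup>2) 1"
    using std_normal_moment_even[of 1] by simp
  have "has_bochner_integral std_gauss (\<lambda>x. x) 0" "has_bochner_integral std_gauss (\<lambda>x. x\<^sup>2) 1"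
    using m1 m2 by (auto intro!: has_bochner_integral_density)
  moreover have "has_bochner_integral (gaussian_noise n) (\<lambda>z. f (z i)) x"
    if "has_bochner_integral std_gauss f x" for f :: "real \<Rightarrow> real" and x
    using that borel_measurable_has_bochner_integral[OF that]
      integrable_distr[OF c, of f] integral_distr[OF c, of f] distr_gaussian_noise[OF assms]
    by (simp add: has_bochner_integral_iff)
  ultimately show "has_bochner_integral (gaussian_noise n) (\<lambda>z. z i) 0"
    "has_bochner_integral (gaussian_noise n) (\<lambda>z. (z i)\<^sup>2) 1"
    by blast+
qed

section \<open>Bayes risk of a single random spike in one block\<close>

lemma measurable_observation [measurable]:
  "observation n \<sigma> \<theta> \<in> measurable (vec_space n) (vec_space n)"
  unfolding observation_def by measurable

text \<open>A change of signal is traded for a displacement of the noise, so that the shift formula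
  applies to the risk at a spiked signal.\<close>

lemma observation_fun_upd:
  assumes "\<sigma> \<noteq> 0" "\<theta> j = 0" "j < n"
  shows "observation n \<sigma> (\<theta>(j := t)) z = observation n \<sigma> \<theta> (z(j := z j + t / \<sigma>))"
  using assms by (auto simp: observation_def fun_eq_iff field_simps restrict_def)

text \<open>Complete the square in \<open>d\<close>: the weighted loss is smallest at the weighted
  mean of \<open>t\<close>. With posterior weights this says that the posterior mean is optimal,
  here without normalising the weights.\<close>

lemma weighted_square_completion:
  fixes w t :: "'a \<Rightarrow> real"
  assumes "(\<Sum>v\<in>V. w v) > 0"
  shows "(\<Sum>v\<in>V. w v * (t v)\<^sup>2) \<le>
    (\<Sum>v\<in>V. w v * (d - t v)\<^sup>2) + (\<Sum>v\<in>V. w v * t v)\<^sup>2 / (\<Sum>v\<in>V. w v)"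
proof -
  define W S where "W = (\<Sum>v\<in>V. w v)" and "S = (\<Sum>v\<in>V. w v * t v)"
  have W: "W > 0" using assms by (simp add: W_def)
  have "(\<Sum>v\<in>V. w v * (d - t v)\<^sup>2) = (\<Sum>v\<in>V. d\<^sup>2 * w v - 2 * d * (w v * t v) + w v * (t v)\<^sup>2)"
    by (intro sum.cong) (simp_all add: power2_eq_square algebra_simps)
  also have "\<dots> = d\<^sup>2 * W - 2 * d * S + (\<Sum>v\<in>V. w v * (t v)\<^sup>2)"
    by (simp add: W_def S_def sum.distrib sum_subtractf sum_distrib_left)
  also have "d\<^sup>2 * W - 2 * d * S = W * (d - S / W)\<^sup>2 - S\<^sup>2 / W"
    using W by (simp add: power2_eq_square field_simps)
  finally show ?thesis
    using W by (simp add: W_def[symmetric] S_def[symmetric])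
qed

lemma exp_add_exp_minus_ge: "exp x + exp (- x) \<ge> 2" for x :: real
  using cosh_real_ge_1[of x] by (simp add: cosh_def)

text \<open>
  The denominator of the posterior mean, a sum of hyperbolic cosines over the block, is at least
  \<open>2 * card B\<close> times its constant factor; this leaves a bound whose noise expectation is explicit.
\<close>

lemma spike_block_pointwise:
  fixes z d \<theta> :: "nat \<Rightarrow> real"
  assumes B: "finite B" "B \<noteq> {}" and \<theta>: "\<And>i. i \<in> B \<Longrightarrow> \<theta> i = 0"
  shows "(\<Sum>j\<in>B. t\<^sup>2 * exp (- a\<^sup>2 / 2) * (exp (a * z j) + exp (- a * z j))) \<le>
     (\<Sum>(j, s)\<in>B \<times> {-1, 1}. (\<Sum>i\<in>B. (d i - (\<theta>(j := s * t)) i)\<^sup>2) * exp (s * a * z j - a\<^sup>2 / 2)) +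
     (\<Sum>j\<in>B. t\<^sup>2 * exp (- a\<^sup>2 / 2) * (exp (2 * a * z j) + exp (- 2 * a * z j) - 2) / (2 * card B))"
proof -
  \<comment> \<open>A pair \<open>v\<close> is the position and sign of the spike;
    \<open>p v\<close> is its likelihood ratio against spike-free noise and \<open>T v\<close> its
    signal on the block.\<close>
  define V where "V = B \<times> {-1, 1 :: real}"
  define p where "p = (\<lambda>v. exp (snd v * a * z (fst v) - a\<^sup>2 / 2))"
  define T where "T = (\<lambda>(v :: nat \<times> real) i. if fst v = i then snd v * t else (0::real))"
  define e where "e = exp (- a\<^sup>2 / 2)"
  have e: "e > 0" by (simp add: e_def)
  have p_eq: "p (j, 1) = e * exp (a * z j)" "p (j, -1) = e * exp (- a * z j)" for j
    by (simp_all add: p_def e_def flip: exp_add)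
  have sumV: "(\<Sum>v\<in>V. g v) = (\<Sum>j\<in>B. g (j, -1) + g (j, 1))" for g :: "nat \<times> real \<Rightarrow> real"
    by (simp add: V_def sum.cartesian_product' add_ac)
  have m: "real (card B) > 0" using B by (simp add: card_gt_0_iff)
  have W_ge: "(\<Sum>v\<in>V. p v) \<ge> 2 * real (card B) * e"
  proof -
    have "2 * real (card B) * e = (\<Sum>j\<in>B. e * 2)" by simp
    also have "\<dots> \<le> (\<Sum>j\<in>B. e * (exp (a * z j) + exp (- (a * z j))))"
      using e exp_add_exp_minus_ge by (intro sum_mono mult_left_mono) auto
    also have "\<dots> = (\<Sum>v\<in>V. p v)" by (simp add: sumV p_eq algebra_simps)
    finally show ?thesis .
  qed
  hence W: "(\<Sum>v\<in>V. p v) > 0" using m e by (smt (verit) mult_pos_pos)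
  have T_sum: "(\<Sum>v\<in>V. p v * T v i) = t * e * (exp (a * z i) - exp (- a * z i))" if "i \<in> B" for i
  proof -
    have "(\<Sum>v\<in>V. p v * T v i) = (\<Sum>j\<in>B. if j = i then t * e * (exp (a * z i) - exp (- a * z i)) else 0)"
      unfolding sumV by (intro sum.cong) (auto simp: T_def p_eq algebra_simps)
    thus ?thesis using that B by simp
  qed
  have T_sq: "(\<Sum>i\<in>B. (T v i)\<^sup>2) = t\<^sup>2" if "v \<in> V" for v
  proof -
    have "(\<Sum>i\<in>B. (T v i)\<^sup>2) = (\<Sum>i\<in>B. if fst v = i then t\<^sup>2 else 0)"
      using that by (intro sum.cong) (auto simp: T_def V_def)
    thus ?thesis using that B by (auto simp: V_def)
  qed
  have "(\<Sum>j\<in>B. t\<^sup>2 * e * (exp (a * z j) + exp (- a * z j))) = (\<Sum>v\<in>V. p v * t\<^sup>2)"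
    by (simp add: sumV p_eq algebra_simps)
  also have "\<dots> = (\<Sum>v\<in>V. \<Sum>i\<in>B. p v * (T v i)\<^sup>2)"
    by (simp add: T_sq flip: sum_distrib_left)
  also have "\<dots> = (\<Sum>i\<in>B. \<Sum>v\<in>V. p v * (T v i)\<^sup>2)"
    by (rule sum.swap)
  \<comment> \<open>The square is completed in each coordinate separately: \<open>d i\<close> is the
    same number for every \<open>v\<close>, as an estimate depends on the data alone.\<close>
  also have "\<dots> \<le> (\<Sum>i\<in>B. (\<Sum>v\<in>V. p v * (d i - T v i)\<^sup>2) + (\<Sum>v\<in>V. p v * T v i)\<^sup>2 / (\<Sum>v\<in>V. p v))"
    by (intro sum_mono weighted_square_completion W)
  also have "\<dots> \<le> (\<Sum>i\<in>B. (\<Sum>v\<in>V. p v * (d i - T v i)\<^sup>2) +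
      t\<^sup>2 * e * (exp (2 * a * z i) + exp (- 2 * a * z i) - 2) / (2 * card B))"
  proof (intro sum_mono add_left_mono)
    fix i assume i: "i \<in> B"
    have "(\<Sum>v\<in>V. p v * T v i)\<^sup>2 / (\<Sum>v\<in>V. p v) \<le> (\<Sum>v\<in>V. p v * T v i)\<^sup>2 / (2 * real (card B) * e)"
      using W_ge W m e by (intro divide_left_mono mult_pos_pos) auto
    also have "\<dots> = t\<^sup>2 * e * (exp (a * z i) - exp (- a * z i))\<^sup>2 / (2 * card B)"
      using m e by (simp add: T_sum i power2_eq_square field_simps)
    also have "(exp (a * z i) - exp (- a * z i))\<^sup>2 = exp (2 * a * z i) + exp (- 2 * a * z i) - 2"
      by (simp add: power2_eq_square algebra_simps flip: exp_add)
    finally show "(\<Sum>v\<in>V. p v * T v i)\<^sup>2 / (\<Sum>v\<in>V. p v) \<le>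
      t\<^sup>2 * e * (exp (2 * a * z i) + exp (- 2 * a * z i) - 2) / (2 * card B)" .
  qed
  also have "\<dots> = (\<Sum>v\<in>V. (\<Sum>i\<in>B. (d i - T v i)\<^sup>2) * p v) +
      (\<Sum>i\<in>B. t\<^sup>2 * e * (exp (2 * a * z i) + exp (- 2 * a * z i) - 2) / (2 * card B))"
    by (simp add: sum.distrib sum_distrib_left mult.commute sum.swap[of _ V B])
  also have "(\<Sum>v\<in>V. (\<Sum>i\<in>B. (d i - T v i)\<^sup>2) * p v) =
      (\<Sum>(j, s)\<in>V. (\<Sum>i\<in>B. (d i - (\<theta>(j := s * t)) i)\<^sup>2) * exp (s * a * z j - a\<^sup>2 / 2))"
    by (intro sum.cong refl) (auto simp: T_def p_def V_def \<theta> intro!: sum.cong)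
  finally show ?thesis unfolding e_def V_def .
qed

text \<open>The estimator still sees the whole observation and only the loss is restricted, so the
  risks of one estimator over disjoint blocks add up to at most its total risk.\<close>

definition block_risk ::
  "nat \<Rightarrow> real \<Rightarrow> nat set \<Rightarrow> ((nat \<Rightarrow> real) \<Rightarrow> (nat \<Rightarrow> real)) \<Rightarrow> (nat \<Rightarrow> real) \<Rightarrow> ennreal" where
  "block_risk n \<sigma> B est \<theta> =
     (\<integral>\<^sup>+ z. ennreal (\<Sum>i\<in>B. (est (observation n \<sigma> \<theta> z) i - \<theta> i)\<^sup>2) \<partial>gaussian_noise n)"

lemma measurable_estimator_component:
  assumes "est \<in> measurable (vec_space n) (vec_space n)" "i < n"
  shows "(\<lambda>z. est (observation n \<sigma> \<theta> z) i) \<in> borel_measurable (vec_space n)"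
  using measurable_compose[OF measurable_compose[OF measurable_observation assms(1)],
      OF measurable_component_singleton[of i "{..<n}" "\<lambda>_. borel"]] assms(2)
  by simp

text \<open>Integrate the pointwise bound over spike-free noise; the shift formula turns each
  weighted loss into the block risk at a spiked signal. Outside \<open>B\<close> the vector
  \<open>\<theta>\<close> is arbitrary but fixed, as if the other spikes were known. The bound is
  for the sum over all \<open>2 * card B\<close> spikes, not their average.\<close>

lemma spike_block_risk_ge:
  fixes \<theta> :: "nat \<Rightarrow> real" and t :: real
  assumes B: "B \<subseteq> {..<n}" "B \<noteq> {}" and \<theta>: "\<And>i. i \<in> B \<Longrightarrow> \<theta> i = 0"
    and est: "est \<in> measurable (vec_space n) (vec_space n)" and \<sigma>: "\<sigma> > 0"
  defines "a \<equiv> t / \<sigma>"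
  shows "ennreal (2 * card B * t\<^sup>2 - t\<^sup>2 * exp (- a\<^sup>2 / 2) * (exp (2 * a\<^sup>2) - 1)) \<le>
    (\<Sum>(j, s)\<in>B \<times> {-1, 1}. block_risk n \<sigma> B est (\<theta>(j := s * t)))"
proof -
  let ?\<gamma> = "gaussian_noise n"
  interpret prob_space ?\<gamma> by (rule prob_space_gaussian_noise)
  have finB: "finite B" using B finite_subset by blast
  have m: "real (card B) > 0" using B finB by (simp add: card_gt_0_iff)
  define V where "V = B \<times> {-1, 1 :: real}"
  define e where "e = exp (- a\<^sup>2 / 2)"
  define F where "F = (\<lambda>v z. ennreal (\<Sum>i\<in>B. (est (observation n \<sigma> \<theta> z) i - (\<theta>(fst v := snd v * t)) i)\<^sup>2))"
  \<comment> \<open>Each likelihood ratio has mean 1, so \<open>L\<close> integrates to the total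
    energy of the \<open>2 * card B\<close> spikes; \<open>G\<close> bounds the part that the
    posterior mean recovers.\<close>
  define L where "L = (\<lambda>z. \<Sum>j\<in>B. t\<^sup>2 * e * (exp (a * z j) + exp (- a * z j)))"
  define G where "G = (\<lambda>z. \<Sum>j\<in>B. t\<^sup>2 * e * (exp (2 * a * z j) + exp (- 2 * a * z j) - 2) / (2 * card B))"
  have L: "has_bochner_integral ?\<gamma> L (\<Sum>j\<in>B. t\<^sup>2 * e * (exp (a\<^sup>2 / 2) + exp ((-a)\<^sup>2 / 2)))"
    unfolding L_def using B
    by (intro has_bochner_integral_sum has_bochner_integral_mult_right has_bochner_integral_add
        has_bochner_integral_gaussian_noise_exp) auto
  have G: "has_bochner_integral ?\<gamma> G
      (\<Sum>j\<in>B. t\<^sup>2 * e * (exp ((2 * a)\<^sup>2 / 2) + exp ((- 2 * a)\<^sup>2 / 2) - 2) / (2 * card B))"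
    unfolding G_def using B
    by (intro has_bochner_integral_sum has_bochner_integral_divide has_bochner_integral_mult_right
        has_bochner_integral_diff has_bochner_integral_add
        has_bochner_integral_gaussian_noise_exp) (auto simp: has_bochner_integral_iff prob_space)
  have L_val: "(\<Sum>j\<in>B. t\<^sup>2 * e * (exp (a\<^sup>2 / 2) + exp ((-a)\<^sup>2 / 2))) = 2 * card B * t\<^sup>2"
    by (simp add: e_def exp_minus)
  have G_val: "(\<Sum>j\<in>B. t\<^sup>2 * e * (exp ((2 * a)\<^sup>2 / 2) + exp ((- 2 * a)\<^sup>2 / 2) - 2) / (2 * card B))
      = t\<^sup>2 * e * (exp (2 * a\<^sup>2) - 1)"
    using m by (simp add: power_mult_distrib field_simps)
  have G_nonneg: "0 \<le> G z" for z
    unfolding G_def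
  proof (intro sum_nonneg)
    fix j
    show "0 \<le> t\<^sup>2 * e * (exp (2 * a * z j) + exp (- 2 * a * z j) - 2) / (2 * card B)"
      using exp_add_exp_minus_ge[of "2 * a * z j"] by (simp add: e_def)
  qed
  have L_nonneg: "0 \<le> L z" for z
    unfolding L_def by (intro sum_nonneg) (simp add: e_def)
  have Fmeas: "F v \<in> borel_measurable (vec_space n)" if "v \<in> V" for v
  proof -
    have [measurable]: "(\<lambda>z. est (observation n \<sigma> \<theta> z) i) \<in> borel_measurable (vec_space n)" if "i \<in> B" for i
      using that B est by (intro measurable_estimator_component) auto
    show ?thesis unfolding F_def by measurable
  qed
  have "ennreal (2 * card B * t\<^sup>2) = (\<integral>\<^sup>+ z. ennreal (L z) \<partial>?\<gamma>)"
    using L[unfolded L_val] L_nonneg by (simp add: has_bochner_integral_iff nn_integral_eq_integral)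
  also have "\<dots> \<le> (\<integral>\<^sup>+ z. (\<Sum>v\<in>V. F v z * ennreal (exp (snd v * a * z (fst v) - (snd v * a)\<^sup>2 / 2))) + ennreal (G z) \<partial>?\<gamma>)"
  proof (rule nn_integral_mono)
    fix z
    have "L z \<le> (\<Sum>(j, s)\<in>V. (\<Sum>i\<in>B. (est (observation n \<sigma> \<theta> z) i - (\<theta>(j := s * t)) i)\<^sup>2) * exp (s * a * z j - a\<^sup>2 / 2)) + G z"
      unfolding L_def G_def V_def e_def using finB B(2) \<theta> by (rule spike_block_pointwise)
    \<comment> \<open>Signs square to 1, so \<open>a\<^sup>2\<close> may be written
      \<open>(snd v * a)\<^sup>2\<close>, the form that the shift formula has for a displacement by
      \<open>snd v * a\<close>.\<close>
    also have "(\<Sum>(j, s)\<in>V. (\<Sum>i\<in>B. (est (observation n \<sigma> \<theta> z) i - (\<theta>(j := s * t)) i)\<^sup>2) * exp (s * a * z j - a\<^sup>2 / 2))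
       = (\<Sum>v\<in>V. (\<Sum>i\<in>B. (est (observation n \<sigma> \<theta> z) i - (\<theta>(fst v := snd v * t)) i)\<^sup>2) * exp (snd v * a * z (fst v) - (snd v * a)\<^sup>2 / 2))"
      by (intro sum.cong) (auto simp: V_def cong: if_cong)
    finally have "ennreal (L z) \<le> ennreal ((\<Sum>v\<in>V. (\<Sum>i\<in>B. (est (observation n \<sigma> \<theta> z) i - (\<theta>(fst v := snd v * t)) i)\<^sup>2) * exp (snd v * a * z (fst v) - (snd v * a)\<^sup>2 / 2)) + G z)"
      by (rule ennreal_leI)
    also have "\<dots> = (\<Sum>v\<in>V. F v z * ennreal (exp (snd v * a * z (fst v) - (snd v * a)\<^sup>2 / 2))) + ennreal (G z)"
      using G_nonneg unfolding F_def
      by (subst ennreal_plus) (auto intro!: sum_nonneg mult_nonneg_nonneg simp: ennreal_mult sum_nonneg simp flip: sum_ennreal)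
    finally show "ennreal (L z) \<le> (\<Sum>v\<in>V. F v z * ennreal (exp (snd v * a * z (fst v) - (snd v * a)\<^sup>2 / 2))) + ennreal (G z)" .
  qed
  also have "\<dots> = (\<Sum>v\<in>V. \<integral>\<^sup>+ z. F v z * ennreal (exp (snd v * a * z (fst v) - (snd v * a)\<^sup>2 / 2)) \<partial>?\<gamma>) + (\<integral>\<^sup>+ z. ennreal (G z) \<partial>?\<gamma>)"
  proof -
    have cm: "(\<lambda>z. z (fst v)) \<in> borel_measurable ?\<gamma>" if "v \<in> V" for v
      using that B by (auto simp: V_def)
    have m1: "(\<lambda>z. F v z * ennreal (exp (snd v * a * z (fst v) - (snd v * a)\<^sup>2 / 2))) \<in> borel_measurable ?\<gamma>" if "v \<in> V" for v
      using Fmeas[OF that] cm[OF that] by measurable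
    have "G \<in> borel_measurable ?\<gamma>" using G by (auto dest: borel_measurable_has_bochner_integral)
    thus ?thesis
      using m1 by (subst nn_integral_add) (auto simp: nn_integral_sum)
  qed
  also have "(\<Sum>v\<in>V. \<integral>\<^sup>+ z. F v z * ennreal (exp (snd v * a * z (fst v) - (snd v * a)\<^sup>2 / 2)) \<partial>?\<gamma>)
      = (\<Sum>v\<in>V. block_risk n \<sigma> B est (\<theta>(fst v := snd v * t)))"
  proof (rule sum.cong[OF refl])
    fix v assume v: "v \<in> V"
    hence j: "fst v < n" "\<theta> (fst v) = 0" using B \<theta> by (auto simp: V_def)
    show "(\<integral>\<^sup>+ z. F v z * ennreal (exp (snd v * a * z (fst v) - (snd v * a)\<^sup>2 / 2)) \<partial>?\<gamma>) =
        block_risk n \<sigma> B est (\<theta>(fst v := snd v * t))"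
      using nn_integral_gaussian_noise_shift[OF Fmeas[OF v] j(1), of "snd v * a"]
        observation_fun_upd[of \<sigma> \<theta> "fst v" n "snd v * t"] \<sigma> j
      by (simp add: block_risk_def F_def a_def)
  qed
  also have "(\<integral>\<^sup>+ z. ennreal (G z) \<partial>?\<gamma>) = ennreal (t\<^sup>2 * e * (exp (2 * a\<^sup>2) - 1))"
    using G[unfolded G_val] G_nonneg by (simp add: has_bochner_integral_iff nn_integral_eq_integral)
  finally have "ennreal (2 * card B * t\<^sup>2) - ennreal (t\<^sup>2 * e * (exp (2 * a\<^sup>2) - 1)) \<le>
      (\<Sum>v\<in>V. block_risk n \<sigma> B est (\<theta>(fst v := snd v * t)))"
    by (simp add: ennreal_minus_le_iff add.commute fun_upd_def)
  \<comment> \<open>With a nonnegative subtrahend the truncated difference is \<open>ennreal\<close>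
    of the real difference; both are 0 if that is negative.\<close>
  moreover have "0 \<le> t\<^sup>2 * e * (exp (2 * a\<^sup>2) - 1)" by (simp add: e_def)
  ultimately show ?thesis
    by (simp add: ennreal_minus e_def V_def case_prod_beta)
qed

section \<open>The product prior over blocks and the worst-case risk\<close>

text \<open>Exchanging the old value \<open>c b\<close> with the new value \<open>v\<close> is an
  involution on the pairs \<open>(c, v)\<close>. In probabilistic terms, redrawing one coordinate
  preserves the uniform law.\<close>

lemma sum_PiE_resample:
  fixes f :: "('b \<Rightarrow> 'v) \<Rightarrow> ennreal"
  assumes b: "b \<in> I"
  shows "(\<Sum>c\<in>PiE I V. \<Sum>v\<in>V b. f (c(b := v))) = of_nat (card (V b)) * (\<Sum>c\<in>PiE I V. f c)"
proof -
  have "(\<Sum>c\<in>PiE I V. \<Sum>v\<in>V b. f (c(b := v))) = (\<Sum>(c, v)\<in>PiE I V \<times> V b. f (c(b := v)))"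
    by (rule sum.cartesian_product)
  also have "\<dots> = (\<Sum>(c, v)\<in>PiE I V \<times> V b. f c)"
    by (rule sum.reindex_bij_witness[where i = "\<lambda>(c, v). (c(b := v), c b)" and j = "\<lambda>(c, v). (c(b := v), c b)"])
       (use b in \<open>auto simp: PiE_iff extensional_def\<close>)
  also have "\<dots> = (\<Sum>c\<in>PiE I V. \<Sum>v\<in>V b. f c)"
    by (rule sum.cartesian_product[symmetric])
  finally show ?thesis by (simp add: sum_distrib_left)
qed

text \<open>
  The coordinates are cut into blocks \<open>{i. i div m = b}\<close>; the pair \<open>c b\<close> is the position and the
  sign of the single spike in block \<open>b\<close>.
\<close>

definition spike_vector :: "nat \<Rightarrow> nat \<Rightarrow> nat \<Rightarrow> real \<Rightarrow> (nat \<Rightarrow> nat \<times> real) \<Rightarrow> (nat \<Rightarrow> real)" where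
  "spike_vector n k m t c = (\<lambda>i\<in>{..<n}.
     if i div m < k \<and> i = fst (c (i div m)) then snd (c (i div m)) * t else 0)"

definition spike_configs :: "nat \<Rightarrow> nat \<Rightarrow> (nat \<Rightarrow> nat \<times> real) set" where
  "spike_configs k m = (\<Pi>\<^sub>E b\<in>{..<k}. {i. i div m = b} \<times> {-1, 1})"

lemma div_block:
  assumes "m > 0"
  shows "{i :: nat. i div m = b} = {b * m..<b * m + m}"
  using assms
  by (auto simp: div_nat_eqI mult.commute[of _ m] dividend_less_times_div add.commute[of _ m])

text \<open>Each of the \<open>k\<close> blocks carries at most one spike, of square
  \<open>t\<^sup>2\<close>. Hence the whole prior lives on the parameter space.\<close>

lemma spike_vector_in_param_space:
  assumes c: "c \<in> spike_configs k m"
  shows "spike_vector n k m t c \<in> param_space n k t"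
proof -
  let ?\<theta> = "spike_vector n k m t c"
  define S where "S = {i \<in> {..<n}. ?\<theta> i \<noteq> 0}"
  have "S \<subseteq> (\<lambda>b. fst (c b)) ` {..<k}"
    by (auto simp: S_def spike_vector_def split: if_splits)
  hence cardS: "card S \<le> k"
    using surj_card_le[of "{..<k}" S] by simp
  have "sq_norm n ?\<theta> = (\<Sum>i\<in>S. (?\<theta> i)\<^sup>2)"
    unfolding sq_norm_def by (rule sum.mono_neutral_right) (auto simp: S_def)
  also have "\<dots> \<le> (\<Sum>i\<in>S. t\<^sup>2)"
  proof (rule sum_mono)
    fix i assume "i \<in> S"
    hence i: "i < n" "i div m < k" "i = fst (c (i div m))"
      by (auto simp: S_def spike_vector_def split: if_splits)
    have "c (i div m) \<in> {j. j div m = i div m} \<times> {-1, 1}"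
      using PiE_mem[OF c[unfolded spike_configs_def], of "i div m"] i by simp
    hence "snd (c (i div m)) \<in> {-1, 1}" by auto
    thus "(?\<theta> i)\<^sup>2 \<le> t\<^sup>2" using i by (auto simp: spike_vector_def)
  qed
  also have "\<dots> \<le> real k * t\<^sup>2"
    using cardS by (simp add: mult_right_mono)
  finally show ?thesis
    using cardS by (auto simp: param_space_def l0_norm_def S_def spike_vector_def)
qed

text \<open>Redrawing the spike of block \<open>b\<close> amounts to clearing the block and
  inserting the new spike; the cleared vector is the fixed background that
  \<open>spike_block_risk_ge\<close> requires.\<close>

lemma spike_vector_fun_upd:
  assumes "b < k" "j div m = b" "j < n"
  shows "spike_vector n k m t (c(b := (j, s))) =
    (\<lambda>i. if i < n \<and> i div m = b then 0 else spike_vector n k m t c i)(j := s * t)"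
  using assms by (auto simp: spike_vector_def fun_eq_iff)

text \<open>Losses over disjoint blocks are parts of one sum of squares; coordinates outside all
  blocks are simply dropped.\<close>

lemma mse_ge_sum_block_risk:
  assumes est: "est \<in> measurable (vec_space n) (vec_space n)"
    and I: "finite I" and B: "disjoint_family_on B I" "\<And>b. b \<in> I \<Longrightarrow> B b \<subseteq> {..<n}"
  shows "(\<Sum>b\<in>I. block_risk n \<sigma> (B b) est \<theta>) \<le> mse n \<sigma> est \<theta>"
proof -
  have fin: "finite (B b)" if "b \<in> I" for b
    using B(2)[OF that] finite_subset by blast
  have [measurable]: "(\<lambda>z. est (observation n \<sigma> \<theta> z) i) \<in> borel_measurable (gaussian_noise n)"
    if "i < n" for i
    using measurable_estimator_component[OF est that]
    by (simp cong: measurable_cong_sets add: sets_gaussian_noise)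
  have meas: "(\<lambda>z. ennreal (\<Sum>i\<in>B b. (est (observation n \<sigma> \<theta> z) i - \<theta> i)\<^sup>2))
      \<in> borel_measurable (gaussian_noise n)" if "b \<in> I" for b
  proof -
    have [simp]: "i \<in> B b \<Longrightarrow> i < n" for i using B(2)[OF that] by auto
    show ?thesis by measurable
  qed
  have "(\<Sum>b\<in>I. block_risk n \<sigma> (B b) est \<theta>) =
      (\<integral>\<^sup>+ z. (\<Sum>b\<in>I. ennreal (\<Sum>i\<in>B b. (est (observation n \<sigma> \<theta> z) i - \<theta> i)\<^sup>2)) \<partial>gaussian_noise n)"
    unfolding block_risk_def using meas by (intro nn_integral_sum[symmetric]) auto
  also have "\<dots> \<le> mse n \<sigma> est \<theta>"
    unfolding mse_def
  proof (rule nn_integral_mono)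
    fix z
    have "(\<Sum>b\<in>I. \<Sum>i\<in>B b. (est (observation n \<sigma> \<theta> z) i - \<theta> i)\<^sup>2) =
        (\<Sum>i\<in>(\<Union>b\<in>I. B b). (est (observation n \<sigma> \<theta> z) i - \<theta> i)\<^sup>2)"
      using I fin B(1) by (intro sum.UNION_disjoint[symmetric]) (auto simp: disjoint_family_on_def)
    also have "\<dots> \<le> sq_norm n (\<lambda>i. est (observation n \<sigma> \<theta> z) i - \<theta> i)"
      unfolding sq_norm_def using B(2) by (intro sum_mono2) auto
    finally show "(\<Sum>b\<in>I. ennreal (\<Sum>i\<in>B b. (est (observation n \<sigma> \<theta> z) i - \<theta> i)\<^sup>2)) \<le>
        ennreal (sq_norm n (\<lambda>i. est (observation n \<sigma> \<theta> z) i - \<theta> i))"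
      by (simp add: sum_nonneg ennreal_leI)
  qed
  finally show ?thesis .
qed

text \<open>The worst case dominates the average over all configurations, whose loss splits over the
  blocks. Redrawing only the spike of block \<open>b\<close> keeps the uniform prior, so
  \<open>spike_block_risk_ge\<close> applies in each block with the other spikes fixed.\<close>

lemma worst_case_risk_ge:
  fixes t :: real and k m n :: nat
  assumes est: "est \<in> measurable (vec_space n) (vec_space n)" and \<sigma>: "\<sigma> > 0"
    and m: "m > 0" "k * m \<le> n"
  defines "a \<equiv> t / \<sigma>"
  shows "ennreal (k * (t\<^sup>2 - t\<^sup>2 * exp (- a\<^sup>2 / 2) * (exp (2 * a\<^sup>2) - 1) / (2 * m))) \<le>
    worst_case_risk n (param_space n k t) \<sigma> est" (is "_ \<le> ?R")
\<comment> \<open>An infinite risk makes the bound trivial; otherwise it is a real \<open>w\<close>,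
  and one can divide by the number of configurations.\<close>
proof (cases "?R")
  case (real w)
  \<comment> \<open>This is \<open>2 * m\<close> times the claimed bound per block, because it
    concerns the sum over the \<open>2 * m\<close> spikes of a block.\<close>
  define \<beta> where "\<beta> = 2 * m * t\<^sup>2 - t\<^sup>2 * exp (- a\<^sup>2 / 2) * (exp (2 * a\<^sup>2) - 1)"
  define B where "B = (\<lambda>b. {i :: nat. i div m = b})"
  define V where "V = (\<lambda>b. B b \<times> {-1, 1 :: real})"
  define D where "D = spike_configs k m"
  have D_eq: "D = PiE {..<k} V" by (simp add: D_def spike_configs_def V_def B_def)
  let ?\<theta> = "spike_vector n k m t"
  have B_eq: "B b = {b * m..<b * m + m}" for b
    unfolding B_def by (rule div_block) fact
  have B_sub: "B b \<subseteq> {..<n}" if "b < k" for b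
  proof -
    have "b * m + m \<le> k * m" using that mult_le_mono1[of "Suc b" k m] by simp
    thus ?thesis using m unfolding B_eq by auto
  qed
  have B_ne: "B b \<noteq> {}" for b using m by (simp add: B_eq)
  have B_card: "card (B b) = m" for b by (simp add: B_eq)
  have V_card: "card (V b) = 2 * m" for b by (simp add: V_def card_cartesian_product B_card)
  have finV: "finite (V b)" for b by (simp add: V_def B_eq)
  have finD: "finite D" unfolding D_eq by (intro finite_PiE) (auto simp: finV)
  have "D \<noteq> {}" unfolding D_eq PiE_eq_empty_iff using B_ne by (auto simp: V_def)
  hence cardD: "card D > 0" using finD by (simp add: card_gt_0_iff)
  have step: "ennreal \<beta> \<le> (\<Sum>v\<in>V b. block_risk n \<sigma> (B b) est (?\<theta> (c(b := v))))"
    if b: "b < k" for b c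
  proof -
    define \<theta>\<^sub>0 where "\<theta>\<^sub>0 = (\<lambda>i. if i < n \<and> i div m = b then 0 else ?\<theta> c i)"
    have z: "\<theta>\<^sub>0 i = 0" if "i \<in> B b" for i
      using that B_sub[OF b] by (auto simp: \<theta>\<^sub>0_def B_def)
    have "ennreal \<beta> \<le> (\<Sum>(j, s)\<in>V b. block_risk n \<sigma> (B b) est (\<theta>\<^sub>0(j := s * t)))"
      using spike_block_risk_ge[where \<theta> = \<theta>\<^sub>0 and t = t, OF B_sub[OF b] B_ne z est \<sigma>]
      by (simp add: \<beta>_def V_def B_card a_def)
    also have "\<dots> = (\<Sum>v\<in>V b. block_risk n \<sigma> (B b) est (?\<theta> (c(b := v))))"
    proof (intro sum.cong refl)
      fix v assume "v \<in> V b"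
      then obtain j s where v: "v = (j, s)" "j div m = b" "j < n"
        using B_sub[OF b] by (auto simp: V_def B_def)
      show "(case v of (j, s) \<Rightarrow> block_risk n \<sigma> (B b) est (\<theta>\<^sub>0(j := s * t))) =
          block_risk n \<sigma> (B b) est (?\<theta> (c(b := v)))"
        using spike_vector_fun_upd[OF b v(2,3)] by (simp add: v(1) \<theta>\<^sub>0_def)
    qed
    finally show ?thesis .
  qed
  have "ennreal (k * (card D * \<beta>)) = (\<Sum>b<k. \<Sum>c\<in>D. ennreal \<beta>)"
    by (simp add: ennreal_mult' ennreal_of_nat_eq_real_of_nat)
  also have "\<dots> \<le> (\<Sum>b<k. \<Sum>c\<in>D. \<Sum>v\<in>V b. block_risk n \<sigma> (B b) est (?\<theta> (c(b := v))))"
    by (intro sum_mono step) auto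
  \<comment> \<open>Redrawing block \<open>b\<close> stays within \<open>D\<close> and reaches each
    configuration \<open>2 * m\<close> times.\<close>
  also have "\<dots> = (\<Sum>b<k. of_nat (2 * m) * (\<Sum>c\<in>D. block_risk n \<sigma> (B b) est (?\<theta> c)))"
    unfolding D_eq
    by (intro sum.cong refl, subst sum_PiE_resample[where V = V, of _ _ "\<lambda>c. block_risk n \<sigma> (B _) est (?\<theta> c)"])
       (auto simp: V_card)
  also have "\<dots> = of_nat (2 * m) * (\<Sum>c\<in>D. \<Sum>b<k. block_risk n \<sigma> (B b) est (?\<theta> c))"
    by (simp add: sum.swap[of _ "{..<k}" D] flip: sum_distrib_left)
  also have "\<dots> \<le> of_nat (2 * m) * (\<Sum>c\<in>D. ?R)"
  proof (intro mult_left_mono sum_mono)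
    fix c assume c: "c \<in> D"
    have "(\<Sum>b<k. block_risk n \<sigma> (B b) est (?\<theta> c)) \<le> mse n \<sigma> est (?\<theta> c)"
      using B_sub by (intro mse_ge_sum_block_risk[OF est]) (auto simp: disjoint_family_on_def B_def)
    also have "\<dots> \<le> ?R"
      unfolding worst_case_risk_def using c
      by (intro SUP_upper spike_vector_in_param_space) (simp add: D_def)
    finally show "(\<Sum>b<k. block_risk n \<sigma> (B b) est (?\<theta> c)) \<le> ?R" .
  qed simp
  also have "\<dots> = ennreal (real (2 * m) * (card D * w))"
    using real unfolding ennreal_of_nat_eq_real_of_nat sum_constant
    by (simp add: ennreal_mult')
  finally have "k * (card D * \<beta>) \<le> real (2 * m) * (card D * w)"
    using real(1) by (subst (asm) ennreal_le_iff) auto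
  hence "k * \<beta> \<le> 2 * m * w" using cardD by simp
  hence "k * \<beta> / (2 * m) \<le> w" using m by (simp add: field_simps)
  also have "k * \<beta> / (2 * m) = k * (t\<^sup>2 - t\<^sup>2 * exp (- a\<^sup>2 / 2) * (exp (2 * a\<^sup>2) - 1) / (2 * m))"
    using m by (simp add: \<beta>_def field_simps)
  finally show ?thesis unfolding real(2) by (rule ennreal_leI)
qed simp

section \<open>Exact risk of the linear estimator\<close>

text \<open>The error in coordinate \<open>i\<close> is
  \<open>(\<sigma> * z i - lam * \<theta> i) / (1 + lam)\<close>, and the cross term of its square
  has mean zero.\<close>

lemma mse_linear_estimator:
  assumes lam: "lam > 0"
  shows "mse n \<sigma> (linear_estimator n lam) \<theta> =
    ennreal ((n * \<sigma>\<^sup>2 + lam\<^sup>2 * sq_norm n \<theta>) / (1 + lam)\<^sup>2)"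
proof -
  let ?\<gamma> = "gaussian_noise n"
  interpret prob_space ?\<gamma> by (rule prob_space_gaussian_noise)
  define q where "q = (\<lambda>i z. (\<sigma>\<^sup>2 * (z i)\<^sup>2 - 2 * lam * \<sigma> * \<theta> i * z i + lam\<^sup>2 * (\<theta> i)\<^sup>2) / (1 + lam)\<^sup>2 :: real)"
  have q: "has_bochner_integral ?\<gamma> (q i)
      ((\<sigma>\<^sup>2 * 1 - 2 * lam * \<sigma> * \<theta> i * 0 + lam\<^sup>2 * (\<theta> i)\<^sup>2) / (1 + lam)\<^sup>2)" if "i < n" for i
    unfolding q_def
    by (intro has_bochner_integral_divide has_bochner_integral_add has_bochner_integral_diff
        has_bochner_integral_mult_right has_bochner_integral_gaussian_noise_linear that)
       (simp add: has_bochner_integral_iff prob_space)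
  have "sq_norm n (\<lambda>i. linear_estimator n lam (observation n \<sigma> \<theta> z) i - \<theta> i) = (\<Sum>i<n. q i z)" for z
    unfolding sq_norm_def
  proof (intro sum.cong refl)
    fix i assume "i \<in> {..<n}"
    hence "linear_estimator n lam (observation n \<sigma> \<theta> z) i - \<theta> i = (\<sigma> * z i - lam * \<theta> i) / (1 + lam)"
      using lam by (simp add: linear_estimator_def observation_def field_simps)
    thus "(linear_estimator n lam (observation n \<sigma> \<theta> z) i - \<theta> i)\<^sup>2 = q i z"
      by (simp add: q_def power_divide power2_diff power_mult_distrib mult_ac)
  qed
  moreover have "has_bochner_integral ?\<gamma> (\<lambda>z. \<Sum>i<n. q i z)
      (\<Sum>i<n. (\<sigma>\<^sup>2 * 1 - 2 * lam * \<sigma> * \<theta> i * 0 + lam\<^sup>2 * (\<theta> i)\<^sup>2) / (1 + lam)\<^sup>2)"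
    by (intro has_bochner_integral_sum q) auto
  moreover have "(\<Sum>i<n. (\<sigma>\<^sup>2 * 1 - 2 * lam * \<sigma> * \<theta> i * 0 + lam\<^sup>2 * (\<theta> i)\<^sup>2) / (1 + lam)\<^sup>2) =
      (n * \<sigma>\<^sup>2 + lam\<^sup>2 * sq_norm n \<theta>) / (1 + lam)\<^sup>2"
    by (simp add: sq_norm_def sum.distrib sum_distrib_left flip: sum_divide_distrib)
  moreover have "0 \<le> sq_norm n \<theta>'" for \<theta>'
    by (simp add: sq_norm_def sum_nonneg)
  ultimately show ?thesis
    unfolding mse_def by (metis (no_types, lifting) ext has_bochner_integral_iff nn_integral_eq_integral AE_I2)
qed

text \<open>The risk increases with \<open>sq_norm n \<theta>\<close>, so the supremum sits at the
  largest energy, attained by the value \<open>t\<close> on the first \<open>k\<close>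
  coordinates.\<close>

lemma worst_case_risk_linear_estimator:
  assumes lam: "lam > 0" and k: "k \<le> n" and t: "t \<noteq> 0"
  shows "worst_case_risk n (param_space n k t) \<sigma> (linear_estimator n lam) =
    ennreal ((n * \<sigma>\<^sup>2 + lam\<^sup>2 * (k * t\<^sup>2)) / (1 + lam)\<^sup>2)"
  unfolding worst_case_risk_def mse_linear_estimator[OF lam]
proof (rule antisym)
  show "(SUP \<theta>\<in>param_space n k t. ennreal ((n * \<sigma>\<^sup>2 + lam\<^sup>2 * sq_norm n \<theta>) / (1 + lam)\<^sup>2))
      \<le> ennreal ((n * \<sigma>\<^sup>2 + lam\<^sup>2 * (k * t\<^sup>2)) / (1 + lam)\<^sup>2)"
    by (intro SUP_least ennreal_leI divide_right_mono add_left_mono mult_left_mono)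
       (auto simp: param_space_def)
next
  define \<theta> where "\<theta> = (\<lambda>i\<in>{..<n}. if i < k then t else 0)"
  have "{i \<in> {..<n}. \<theta> i \<noteq> 0} = {..<k}" using k t by (auto simp: \<theta>_def)
  moreover have "sq_norm n \<theta> = k * t\<^sup>2"
  proof -
    have "sq_norm n \<theta> = (\<Sum>i<k. (\<theta> i)\<^sup>2)"
      unfolding sq_norm_def using k by (intro sum.mono_neutral_right) (auto simp: \<theta>_def)
    also have "\<dots> = (\<Sum>i<k. t\<^sup>2)" using k by (intro sum.cong) (auto simp: \<theta>_def)
    finally show ?thesis by simp
  qed
  ultimately have "\<theta> \<in> param_space n k t" "sq_norm n \<theta> = k * t\<^sup>2"
    by (auto simp: param_space_def l0_norm_def \<theta>_def)
  thus "ennreal ((n * \<sigma>\<^sup>2 + lam\<^sup>2 * (k * t\<^sup>2)) / (1 + lam)\<^sup>2) \<le>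
      (SUP \<theta>\<in>param_space n k t. ennreal ((n * \<sigma>\<^sup>2 + lam\<^sup>2 * sq_norm n \<theta>) / (1 + lam)\<^sup>2))"
    by (metis SUP_upper)
qed

lemma measurable_linear_estimator:
  "linear_estimator n lam \<in> measurable (vec_space n) (vec_space n)"
  unfolding linear_estimator_def by measurable

section \<open>Minimax bounds and the second-order expansion\<close>

lemma minimax_risk_le_linear:
  "minimax_risk n \<Theta> \<sigma> \<le> worst_case_risk n \<Theta> \<sigma> (linear_estimator n lam)"
  unfolding minimax_risk_def by (intro INF_lower measurable_linear_estimator)

lemma minimax_risk_ge:
  fixes t :: real and k m n :: nat
  assumes "\<sigma> > 0" "m > 0" "k * m \<le> n"
  defines "a \<equiv> t / \<sigma>"
  shows "ennreal (k * (t\<^sup>2 - t\<^sup>2 * exp (- a\<^sup>2 / 2) * (exp (2 * a\<^sup>2) - 1) / (2 * m))) \<le>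
    minimax_risk n (param_space n k t) \<sigma>"
  unfolding minimax_risk_def a_def using assms by (intro INF_greatest worst_case_risk_ge)

text \<open>As \<open>x\<close> tends to 0, \<open>exp (2 * x\<^sup>2) - 1\<close> is equivalent to
  \<open>2 * x\<^sup>2\<close>. Positivity of \<open>\<mu> n\<close> keeps the quotient away from
  its default value at 0.\<close>

lemma spike_constant_tendsto_1:
  assumes "\<mu> \<longlonglongrightarrow> (0::real)" "\<And>n. 1 \<le> n \<Longrightarrow> \<mu> n > 0"
  shows "(\<lambda>n. exp (- (\<mu> n)\<^sup>2 / 2) * (exp (2 * (\<mu> n)\<^sup>2) - 1) / (2 * (\<mu> n)\<^sup>2)) \<longlonglongrightarrow> 1"
proof -
  have "((\<lambda>x::real. exp (- x\<^sup>2 / 2) * (exp (2 * x\<^sup>2) - 1) / (2 * x\<^sup>2)) \<longlongrightarrow> 1) (at_right 0)"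
    by real_asymp
  moreover have "filterlim \<mu> (at_right 0) sequentially"
    using assms by (auto simp: filterlim_at less_imp_neq[symmetric] intro!: eventually_sequentiallyI[of 1])
  ultimately show ?thesis by (rule filterlim_compose)
qed

theorem theorem3:
  fixes k :: "nat \<Rightarrow> nat" and \<tau> \<sigma> \<epsilon> \<mu> :: "nat \<Rightarrow> real"
  assumes k: "\<And>n. 1 \<le> n \<Longrightarrow> 1 \<le> k n \<and> k n \<le> n"
    and tau: "\<And>n. 1 \<le> n \<Longrightarrow> \<tau> n > 0"
    and sigma: "\<And>n. 1 \<le> n \<Longrightarrow> \<sigma> n > 0"
    and eps: "\<And>n. 1 \<le> n \<Longrightarrow> \<epsilon> n = real (k n) / real n"
    and mu: "\<And>n. 1 \<le> n \<Longrightarrow> \<mu> n = \<tau> n / \<sigma> n"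
    and eps_lim: "\<epsilon> \<longlonglongrightarrow> 0"
    and mu_lim: "\<mu> \<longlonglongrightarrow> 0"
  shows "(\<exists>r :: nat \<Rightarrow> real. r \<longlonglongrightarrow> 0 \<and>
            (\<forall>n\<ge>1. enn2ereal (minimax_risk n (param_space n (k n) (\<tau> n)) (\<sigma> n)) =
               ereal (real n * (\<sigma> n)\<^sup>2 *
                 (\<epsilon> n * (\<mu> n)\<^sup>2 - (\<epsilon> n)\<^sup>2 * (\<mu> n) ^ 4 * (1 + r n))))) \<and>
         (\<exists>r :: nat \<Rightarrow> real. r \<longlonglongrightarrow> 0 \<and>
            (\<forall>n\<ge>1. enn2ereal (worst_case_risk n (param_space n (k n) (\<tau> n)) (\<sigma> n)
                  (linear_estimator n (inverse (\<epsilon> n * (\<mu> n)\<^sup>2)))) =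
               ereal (real n * (\<sigma> n)\<^sup>2 *
                 (\<epsilon> n * (\<mu> n)\<^sup>2 - (\<epsilon> n)\<^sup>2 * (\<mu> n) ^ 4 * (1 + r n)))))"
proof -
  \<comment> \<open>\<open>N n\<close> is the total noise energy, \<open>N n * a n\<close> the
    largest signal energy, and \<open>h\<close> the factor by which the lower bound misses the exact
    second-order coefficient before rounding of the block length.\<close>
  define a where "a = (\<lambda>n. \<epsilon> n * (\<mu> n)\<^sup>2)"
  define N where "N = (\<lambda>n. real n * (\<sigma> n)\<^sup>2)"
  define h where "h = (\<lambda>n. exp (- (\<mu> n)\<^sup>2 / 2) * (exp (2 * (\<mu> n)\<^sup>2) - 1) / (2 * (\<mu> n)\<^sup>2))"
  define R where "R = (\<lambda>n. minimax_risk n (param_space n (k n) (\<tau> n)) (\<sigma> n))"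
  define RL where "RL = (\<lambda>n. worst_case_risk n (param_space n (k n) (\<tau> n)) (\<sigma> n)
                  (linear_estimator n (inverse (\<epsilon> n * (\<mu> n)\<^sup>2))))"
  have eps_pos: "\<epsilon> n > 0" and mu_pos: "\<mu> n > 0" and N_pos: "N n > 0"
    and N_a: "N n * a n = k n * (\<tau> n)\<^sup>2" if "1 \<le> n" for n
    using that k[of n] tau[of n] sigma[of n]
    by (simp_all add: eps mu N_def a_def power_divide)
  have a_pos: "a n > 0" if "1 \<le> n" for n
    using eps_pos[OF that] mu_pos[OF that] by (simp add: a_def)
  have a_eq: "\<epsilon> n * (\<mu> n)\<^sup>2 = a n" for n
    by (simp add: a_def)
  have a_lim: "a \<longlonglongrightarrow> 0"
    unfolding a_def using tendsto_mult[OF eps_lim tendsto_power[OF mu_lim, of 2]] by simp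
  have h_lim: "h \<longlonglongrightarrow> 1"
    unfolding h_def using mu_lim mu_pos by (rule spike_constant_tendsto_1)
  have expand: "real n * (\<sigma> n)\<^sup>2 * (\<epsilon> n * (\<mu> n)\<^sup>2 - (\<epsilon> n)\<^sup>2 * (\<mu> n) ^ 4 * (1 + x)) =
      N n * (a n - (a n)\<^sup>2 * (1 + x))" for n x
    by (simp add: N_def a_def power_mult_distrib flip: power_mult)
  \<comment> \<open>This is the exact remainder for the linear estimator, whose normalised risk is
    \<open>a n / (1 + a n)\<close>.\<close>
  have frac_lim: "(\<lambda>n. - a n / (1 + a n)) \<longlonglongrightarrow> 0"
    using tendsto_divide[OF tendsto_minus[OF a_lim] tendsto_add[OF tendsto_const[of 1] a_lim]] by simp
  have RL: "RL n = ennreal (N n * (a n / (1 + a n)))" if n: "1 \<le> n" for n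
  proof -
    have "RL n = ennreal ((N n + (inverse (a n))\<^sup>2 * (N n * a n)) / (1 + inverse (a n))\<^sup>2)"
      unfolding RL_def N_a[OF n] a_eq using a_pos[OF n] tau[OF n] k[OF n]
      by (simp add: worst_case_risk_linear_estimator N_def)
    also have "N n + (inverse (a n))\<^sup>2 * (N n * a n) = N n * (1 + inverse (a n))"
      using a_pos[OF n] by (simp add: field_simps power2_eq_square)
    also have "\<dots> / (1 + inverse (a n))\<^sup>2 = N n / (1 + inverse (a n))"
      by (simp add: power2_eq_square)
    also have "\<dots> = N n * (a n / (1 + a n))"
      using a_pos[OF n] by (simp add: field_simps)
    finally show ?thesis .
  qed
  have R_le: "R n \<le> ennreal (N n * (a n / (1 + a n)))" if "1 \<le> n" for n
    unfolding RL[OF that, symmetric] R_def RL_def by (rule minimax_risk_le_linear)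
  \<comment> \<open>\<open>enn2real\<close> sends infinity to 0, but the bound by the linear risk
    makes \<open>R n\<close> finite for positive \<open>n\<close>, so nothing is lost.\<close>
  define \<rho> where "\<rho> = (\<lambda>n. enn2real (R n))"
  have R_eq: "R n = ennreal (\<rho> n)" if "1 \<le> n" for n
    using le_less_trans[OF R_le[OF that] ennreal_less_top] by (simp add: \<rho>_def)
  have \<rho>_le: "\<rho> n \<le> N n * (a n / (1 + a n))" if n: "1 \<le> n" for n
    using R_le[OF n] N_pos[OF n] a_pos[OF n] unfolding R_eq[OF n] by (subst (asm) ennreal_le_iff) auto
  have \<rho>_nonneg: "0 \<le> \<rho> n" for n by (simp add: \<rho>_def)
  have \<rho>_ge: "N n * (a n - (a n)\<^sup>2 * (h n / (1 - \<epsilon> n))) \<le> \<rho> n" if n: "1 \<le> n" and e: "\<epsilon> n < 1" for n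
  proof -
    \<comment> \<open>The greatest length for which \<open>k n\<close> blocks fit. Rounding down
      loses fewer than \<open>k n\<close> coordinates, whence
      \<open>1 - \<epsilon> n \<le> \<epsilon> n * m\<close>.\<close>
    define m where "m = n div k n"
    have kn: "k n > 0" "k n \<le> n" using k[OF n] by auto
    have m: "m > 0" "k n * m \<le> n" using kn by (auto simp: m_def div_greater_zero_iff)
    have "n < k n * m + k n"
      using dividend_less_times_div[of "k n" n] kn by (simp add: m_def add.commute)
    hence "real n < real (k n) * real m + real (k n)"
      by (metis of_nat_add of_nat_less_iff of_nat_mult)
    hence "real n * 1 \<le> real n * (\<epsilon> n * m + \<epsilon> n)"
      using n by (simp add: eps distrib_left)
    hence em: "1 - \<epsilon> n \<le> \<epsilon> n * m"
      using n by (subst (asm) mult_le_cancel_left_pos) auto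
    have h: "h n \<ge> 0" by (simp add: h_def)
    have "ennreal (k n * ((\<tau> n)\<^sup>2 - (\<tau> n)\<^sup>2 * exp (- (\<mu> n)\<^sup>2 / 2) * (exp (2 * (\<mu> n)\<^sup>2) - 1) / (2 * m))) \<le> R n"
      unfolding R_def mu[OF n] using sigma[OF n] m by (intro minimax_risk_ge) auto
    hence "k n * ((\<tau> n)\<^sup>2 - (\<tau> n)\<^sup>2 * exp (- (\<mu> n)\<^sup>2 / 2) * (exp (2 * (\<mu> n)\<^sup>2) - 1) / (2 * m)) \<le> \<rho> n"
      unfolding R_eq[OF n] by (subst (asm) ennreal_le_iff) (auto simp: \<rho>_nonneg)
    also have "k n * ((\<tau> n)\<^sup>2 - (\<tau> n)\<^sup>2 * exp (- (\<mu> n)\<^sup>2 / 2) * (exp (2 * (\<mu> n)\<^sup>2) - 1) / (2 * m)) =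
        k n * (\<tau> n)\<^sup>2 * (1 - (\<mu> n)\<^sup>2 * h n / m)"
      using mu_pos[OF n] m by (simp add: h_def field_simps)
    also have "\<dots> = N n * (a n - (a n)\<^sup>2 * (h n / (\<epsilon> n * m)))"
      unfolding N_a[OF n, symmetric] using eps_pos[OF n] m
      by (simp add: a_def field_simps power2_eq_square)
    finally have "N n * (a n - (a n)\<^sup>2 * (h n / (\<epsilon> n * m))) \<le> \<rho> n" .
    moreover have "h n / (\<epsilon> n * m) \<le> h n / (1 - \<epsilon> n)"
      using em e h eps_pos[OF n] m by (intro divide_left_mono) auto
    hence "N n * (a n - (a n)\<^sup>2 * (h n / (1 - \<epsilon> n))) \<le> N n * (a n - (a n)\<^sup>2 * (h n / (\<epsilon> n * m)))"
      using N_pos[OF n] by (intro mult_left_mono diff_left_mono) auto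
    ultimately show ?thesis by linarith
  qed
  \<comment> \<open>The required expansion solved for its remainder; only the limit of
    \<open>r\<close> is left to prove.\<close>
  define r where "r = (\<lambda>n. (a n - \<rho> n / N n) / (a n)\<^sup>2 - 1)"
  have \<rho>_eq: "\<rho> n = N n * (a n - (a n)\<^sup>2 * (1 + r n))" if n: "1 \<le> n" for n
    using N_pos[OF n] a_pos[OF n] by (simp add: r_def field_simps)
  have r_lim: "r \<longlonglongrightarrow> 0"
  proof (rule tendsto_sandwich)
    \<comment> \<open>The remainder enters the risk with a minus sign, so the upper bound on
      \<open>\<rho> n\<close> bounds \<open>r n\<close> from below.\<close>
    show "\<forall>\<^sub>F n in sequentially. - a n / (1 + a n) \<le> r n"
      using eventually_ge_at_top[of 1]
    proof eventually_elim
      case (elim n)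
      have "a n - (a n)\<^sup>2 * (1 + r n) \<le> a n / (1 + a n)"
        using \<rho>_le[OF elim] unfolding \<rho>_eq[OF elim] mult_le_cancel_left_pos[OF N_pos[OF elim]] .
      also have "a n / (1 + a n) = a n - (a n)\<^sup>2 * (1 + - a n / (1 + a n))"
        using a_pos[OF elim] by (simp add: field_simps power2_eq_square)
      finally show ?case using a_pos[OF elim] by simp
    qed
    \<comment> \<open>This side comes from the spike prior and is available once
      \<open>\<epsilon> n < 1\<close>, which holds eventually.\<close>
    show "\<forall>\<^sub>F n in sequentially. r n \<le> h n / (1 - \<epsilon> n) - 1"
      using eventually_ge_at_top[of 1] order_tendstoD(2)[OF eps_lim, of 1, OF zero_less_one]
    proof eventually_elim
      case (elim n)
      have "a n - (a n)\<^sup>2 * (h n / (1 - \<epsilon> n)) \<le> a n - (a n)\<^sup>2 * (1 + r n)"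
        using \<rho>_ge[OF elim] unfolding \<rho>_eq[OF elim(1)] mult_le_cancel_left_pos[OF N_pos[OF elim(1)]] .
      hence "(a n)\<^sup>2 * (1 + r n) \<le> (a n)\<^sup>2 * (h n / (1 - \<epsilon> n))" by linarith
      hence "1 + r n \<le> h n / (1 - \<epsilon> n)"
        using a_pos[OF elim(1)] by (subst (asm) mult_le_cancel_left_pos) auto
      thus ?case by linarith
    qed
    show "(\<lambda>n. h n / (1 - \<epsilon> n) - 1) \<longlonglongrightarrow> 0"
      using tendsto_diff[OF tendsto_divide[OF h_lim tendsto_diff[OF tendsto_const[of 1] eps_lim]] tendsto_const[of 1]]
      by simp
  qed (rule frac_lim)
  have "enn2ereal (R n) = ereal (N n * (a n - (a n)\<^sup>2 * (1 + r n)))" if n: "1 \<le> n" for n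
    using \<rho>_nonneg[of n] unfolding \<rho>_eq[OF n, symmetric] R_eq[OF n] by (simp add: enn2ereal_ennreal)
  moreover have "enn2ereal (RL n) = ereal (N n * (a n - (a n)\<^sup>2 * (1 + - a n / (1 + a n))))"
    if n: "1 \<le> n" for n
  proof -
    have "a n / (1 + a n) = a n - (a n)\<^sup>2 * (1 + - a n / (1 + a n))"
      using a_pos[OF n] by (simp add: field_simps power2_eq_square)
    moreover have "0 \<le> N n * (a n / (1 + a n))" using N_pos[OF n] a_pos[OF n] by simp
    ultimately show ?thesis unfolding RL[OF n] by (metis enn2ereal_ennreal)
  qed
  ultimately show ?thesis
    unfolding expand R_def RL_def using r_lim frac_lim by blast
qed

end
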